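(* Let the operators $\mathcal S^m$, $m\ge 1$, satisfy $$\operatorname{Im}\sum_{m=1}^M\bigl(\mathcal S^m\boldsymbol\Phi^m,\overline s_t\Phi^m\bigr)_{\omega_\delta}\tau_m\ge 0\quad\text{for any } M\ge 1,$$ for any function $\Phi:\overline\omega_\delta\times\overline\omega^{\,\tau}\to\mathbb C$ such that $\Phi^0=0$ and $\Phi|_{k=0,K}=0$, where $\boldsymbol\Phi^m=\{\Phi^1,\dots,\Phi^m\}$. Then, for a solution of the splitting in potential scheme (described in the context, with initial data $\Psi^0_{\mathbf h}$ and perturbation $F^m$), the following stability bound holds: $$\max_{0\le m\le M}\|\sqrt{\rho_{\mathbf h}}\,\Psi^m\|_{\overline\omega_{\mathbf h}}\le\|\sqrt{\rho_{\mathbf h}}\,\Psi^0_{\mathbf h}\|_{\overline\omega_{\mathbf h}}+\frac{2}{\hbar}\sum_{m=1}^M\Bigl\|\frac{F^m}{\sqrt{\rho_{\mathbf h}}}\Bigr\|_{\overline\omega_{\mathbf h}}\tau_m\quad\text{for any } M\ge 1.$$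
   Context: **Coefficients.** $\Omega=(0,\infty)\times(0,Y)$, $\Omega_X=(0,X)\times(0,Y)$, $\hbar>0$ constant. Real functions $\rho(x,y)\ge\underline\rho>0$, $V(x,y)$ and a real symmetric matrix $\mathbf B=\{B_{pq}(x,y)\}_{p,q=1}^2$, positive definite uniformly in $\Omega$, are given, and $\psi^0(x,y)$ is a complex-valued initial function. For some $X_0>0$, on $\Omega\setminus\Omega_{X_0}$: $B_{11}=B_{1\infty}>0$, $B_{12}=B_{21}=0$, $B_{22}=B_{2\infty}>0$, $\rho=\rho_\infty>0$, $V=V_\infty$ (constants), $\psi^0=0$. A real auxiliary potential $\widetilde V(x)$ satisfies $\widetilde V(x)=V_\infty$ for $x\ge X_0$. **Meshes.** $\overline\omega^{\,\tau}$: nodes $0=t_0<t_1<\dots$, $t_m\to\infty$, $\tau_m=t_m-t_{m-1}$. In $x$: nodes $0=x_0<\dots<x_J=X<\dots$ on $[0,\infty)$, where $X>X_0$, with $h_j=x_j-x_{j-1}$, $x_{J-2}\ge X_0$, $h_j=h:=h_J$ for $j\ge J$; $h_{j+1/2}=\frac{h_j+h_{j+1}}2$; $\overline\omega_h=\{x_j\}_{j=0}^J$, $\omega_h=\{x_j\}_{j=1}^{J-1}$. In $y$: $\overline\omega_\delta$ with nodes $0=y_0<\dots<y_K=Y$, $\delta_k=y_k-y_{k-1}$, $\delta_{k+1/2}=\frac{\delta_k+\delta_{k+1}}2$, $\omega_\delta=\{y_k\}_{k=1}^{K-1}$. $\overline\omega_{\mathbf h}=\overline\omega_h\times\overline\omega_\delta$,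 $\omega_{\mathbf h}=\omega_h\times\omega_\delta$, $\Gamma_{\mathbf h}=\{(0,y_k):1\le k\le K-1\}\cup\{(x_j,0),(x_j,Y):0\le j\le J\}$. **Mesh operators.** $\overline\partial_xW_j=\frac{W_j-W_{j-1}}{h_j}$, $\widehat\partial_xW_j=\frac{W_{j+1}-W_j}{h_{j+1/2}}$, $\overline s_xW_j=\frac{W_{j-1}+W_j}2$, $\widehat s_xW_j=\frac{h_jW_j+h_{j+1}W_{j+1}}{2h_{j+1/2}}$; $\overline\partial_y,\widehat\partial_y,\overline s_y,\widehat s_y$ are defined likewise in the index $k$ with steps $\delta_k,\delta_{k+1/2}$. $\overline s_t\Phi^m=\frac{\Phi^{m-1}+\Phi^m}2$. **Discrete coefficients.** $A_{-,jk}=A(\frac{x_{j-1}+x_j}2,\frac{y_{k-1}+y_k}2)$ for $A=\rho,B_{pq},V$ and $\widetilde V_{-,j}=\widetilde V(\frac{x_{j-1}+x_j}2)$; $B_{11\mathbf h}=\widehat s_yB_{11,-}$, $B_{22\mathbf h}=\widehat s_xB_{22,-}$, $B_{12\mathbf h}=B_{21\mathbf h}=B_{12,-}$, $\rho_{\mathbf h}=\widehat s_x\widehat s_y\rho_-$, $V_{\mathbf h}=\widehat s_x\widehat s_yV_-$, $\widetilde V_h=\widehat s_x\widetilde V_-$, $\Delta V_{\mathbf h}=V_{\mathbf h}-\widetilde V_h$. The mesh Hamiltonian is $$\mathcal H_{0\mathbf h}W=-\tfrac{\hbar^2}2\bigl[\widehat\partial_x(B_{11\mathbf h}\overline\partial_xW)+\widehat\partial_x\widehat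 s_y(B_{12\mathbf h}\overline s_x\overline\partial_yW)+\widehat s_x\widehat\partial_y(B_{21\mathbf h}\overline\partial_x\overline s_yW)+\widehat\partial_y(B_{22\mathbf h}\overline\partial_yW)\bigr].$$ **Inner products and norms.** $(U,W)_{\omega_\delta}=\sum_{k=1}^{K-1}U_kW_k^*\delta_{k+1/2}$; $(U,W)_{\overline\omega_{\mathbf h}}=\sum_{j=1}^{J-1}\sum_{k=1}^{K-1}U_{jk}W_{jk}^*h_{j+1/2}\delta_{k+1/2}+\sum_{k=1}^{K-1}U_{Jk}W_{Jk}^*\frac h2\delta_{k+1/2}$, with associated norm $\|\cdot\|_{\overline\omega_{\mathbf h}}$ ($*$ is complex conjugation). **Scheme.** For each $m\ge 1$, $\mathcal S^m$ is a linear operator taking functions on $\omega_\delta\times\{t_l\}_{l=1}^m$ to functions on $\omega_\delta$. Given $F^m:\overline\omega_{\mathbf h}\to\mathbb C$ with $F^m|_{\Gamma_{\mathbf h}}=0$ and $\Psi^0_{\mathbf h}$ with $(\Psi^0_{\mathbf h})_{jk}=\psi^0(x_j,y_k)$, where it is assumed that $\Psi^0_{\mathbf h}|_{j=J}=\Psi^0_{\mathbf h}|_{j=J-1}=0$ and $\Psi^0_{\mathbf h}|_{\Gamma_{\mathbf h}}=0$, the splitting in potential scheme is to find $\Psi^0=\Psi^0_{\mathbf h}$ and, for all $m\ge1$, functions $\breve\Psi^m,\widetilde\Psi^m,\Psi^m$ on $\overline\omega_{\mathbf h}$, vanishing on $\Gamma_{\mathbf h}$, with: (i) $\breve\Psi^m=\mathcal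 E^m\Psi^{m-1}$ and (iii) $\Psi^m=\mathcal E^m\widetilde\Psi^m$ on $(\omega_h\cup\{x_J\})\times\omega_\delta$, where either $\mathcal E^m=\dfrac{1-i\frac{\tau_m}{4\hbar\rho_{\mathbf h}}\Delta V_{\mathbf h}}{1+i\frac{\tau_m}{4\hbar\rho_{\mathbf h}}\Delta V_{\mathbf h}}$ (equivalently $i\hbar\rho_{\mathbf h}\frac{\breve\Psi^m-\Psi^{m-1}}{\tau_m/2}=\Delta V_{\mathbf h}\frac{\breve\Psi^m+\Psi^{m-1}}2$ and $i\hbar\rho_{\mathbf h}\frac{\Psi^m-\widetilde\Psi^m}{\tau_m/2}=\Delta V_{\mathbf h}\frac{\Psi^m+\widetilde\Psi^m}2$), or $\mathcal E^m=\exp\{-i\frac{\tau_m}{2\hbar\rho_{\mathbf h}}\Delta V_{\mathbf h}\}$ (both choices are admitted); (ii) $i\hbar\rho_{\mathbf h}\dfrac{\widetilde\Psi^m-\breve\Psi^m}{\tau_m}=(\mathcal H_{0\mathbf h}+\widetilde V_h)\dfrac{\widetilde\Psi^m+\breve\Psi^m}2+F^m$ on $\omega_{\mathbf h}$; (iv) (approximate transparent boundary condition) on $\omega_\delta$, $$\Bigl\{\tfrac{\hbar^2}2B_{1\infty}\overline\partial_x\tfrac{\widetilde\Psi^m+\breve\Psi^m}2-\tfrac h2\Bigl[i\hbar\rho_\infty\tfrac{\widetilde\Psi^m-\breve\Psi^m}{\tau_m}+\bigl(\tfrac{\hbar^2}2B_{2\infty}\widehat\partial_y\overline\partial_y-V_\infty\bigr)\tfrac{\widetilde\Psi^m+\breve\Psi^m}2\Bigr]\Bigr\}\Big|_{j=J}+\tfrac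 h2F^m|_{j=J}=\tfrac{\hbar^2}2B_{1\infty}\mathcal S^m\widetilde{\boldsymbol\Psi}^m_J,$$ where $\widetilde{\boldsymbol\Psi}^m_J=\{\widetilde\Psi^1_{J\cdot},\dots,\widetilde\Psi^m_{J\cdot}\}$. *)

theory Defs
  imports "HOL-Analysis.Analysis"
begin

definition strip :: "real \<Rightarrow> (real \<times> real) set" where
  "strip Y = {0<..} \<times> {0<..<Y}"

definition strip_upto :: "real \<Rightarrow> real \<Rightarrow> (real \<times> real) set" where
  "strip_upto X Y = {0<..<X} \<times> {0<..<Y}"


text \<open>
  A mesh is given by its nodes \<open>z :: nat \<Rightarrow> real\<close>.  All functions below are total; they are
  meaningful (and used) only at indices for which the nodes involved belong to the mesh.  In
  particular \<open>mesh_step\<close>, \<open>bdiff\<close>, \<open>bavg\<close> are used at indices \<open>\<ge> 1\<close> only.  The value type is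
  polymorphic since the averages are applied both to real coefficients and to complex mesh
  functions.
\<close>

definition mesh_step :: "(nat \<Rightarrow> real) \<Rightarrow> nat \<Rightarrow> real" where
  "mesh_step z n = z n - z (n - 1)"

text \<open>The step with index \<open>n + 1/2\<close>.\<close>

definition half_step :: "(nat \<Rightarrow> real) \<Rightarrow> nat \<Rightarrow> real" where
  "half_step z n = (mesh_step z n + mesh_step z (n + 1)) / 2"

definition bdiff :: "(nat \<Rightarrow> real) \<Rightarrow> (nat \<Rightarrow> 'a::real_vector) \<Rightarrow> nat \<Rightarrow> 'a" where
  "bdiff z W n = (W n - W (n - 1)) /\<^sub>R mesh_step z n"

definition fdiff :: "(nat \<Rightarrow> real) \<Rightarrow> (nat \<Rightarrow> 'a::real_vector) \<Rightarrow> nat \<Rightarrow> 'a" where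
  "fdiff z W n = (W (n + 1) - W n) /\<^sub>R half_step z n"

definition bavg :: "(nat \<Rightarrow> 'a::real_vector) \<Rightarrow> nat \<Rightarrow> 'a" where
  "bavg W n = (W (n - 1) + W n) /\<^sub>R 2"

definition favg :: "(nat \<Rightarrow> real) \<Rightarrow> (nat \<Rightarrow> 'a::real_vector) \<Rightarrow> nat \<Rightarrow> 'a" where
  "favg z W n =
     (mesh_step z n *\<^sub>R W n + mesh_step z (n + 1) *\<^sub>R W (n + 1)) /\<^sub>R (2 * half_step z n)"


text \<open>Mesh functions \<open>W j k\<close> carry the \<open>x\<close>-index first.\<close>

definition along_x :: "((nat \<Rightarrow> 'a) \<Rightarrow> nat \<Rightarrow> 'b) \<Rightarrow> (nat \<Rightarrow> nat \<Rightarrow> 'a) \<Rightarrow> nat \<Rightarrow> nat \<Rightarrow> 'b" where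
  "along_x T W j k = T (\<lambda>i. W i k) j"

definition along_y :: "((nat \<Rightarrow> 'a) \<Rightarrow> nat \<Rightarrow> 'b) \<Rightarrow> (nat \<Rightarrow> nat \<Rightarrow> 'a) \<Rightarrow> nat \<Rightarrow> nat \<Rightarrow> 'b" where
  "along_y T W j k = T (W j) k"

definition midpoint1 :: "(nat \<Rightarrow> real) \<Rightarrow> nat \<Rightarrow> real" where
  "midpoint1 z n = (z (n - 1) + z n) / 2"

definition cell_values ::
    "(nat \<Rightarrow> real) \<Rightarrow> (nat \<Rightarrow> real) \<Rightarrow> (real \<Rightarrow> real \<Rightarrow> real) \<Rightarrow> nat \<Rightarrow> nat \<Rightarrow> real" where
  "cell_values x y A j k = A (midpoint1 x j) (midpoint1 y k)"

definition node_coeff ::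
    "(nat \<Rightarrow> real) \<Rightarrow> (nat \<Rightarrow> real) \<Rightarrow> (real \<Rightarrow> real \<Rightarrow> real) \<Rightarrow> nat \<Rightarrow> nat \<Rightarrow> real" where
  "node_coeff x y A = along_x (favg x) (along_y (favg y) (cell_values x y A))"

definition node_coeff1 :: "(nat \<Rightarrow> real) \<Rightarrow> (real \<Rightarrow> real) \<Rightarrow> nat \<Rightarrow> real" where
  "node_coeff1 x A = favg x (\<lambda>j. A (midpoint1 x j))"

definition mesh_hamiltonian ::
    "real \<Rightarrow> (real \<Rightarrow> real \<Rightarrow> real^2^2) \<Rightarrow> (nat \<Rightarrow> real) \<Rightarrow> (nat \<Rightarrow> real)
      \<Rightarrow> (nat \<Rightarrow> nat \<Rightarrow> complex) \<Rightarrow> nat \<Rightarrow> nat \<Rightarrow> complex" where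
  "mesh_hamiltonian hbar B x y W = (\<lambda>j k.
     let B11 = along_y (favg y) (cell_values x y (\<lambda>a b. B a b $ 1 $ 1));
         B22 = along_x (favg x) (cell_values x y (\<lambda>a b. B a b $ 2 $ 2));
         B12 = cell_values x y (\<lambda>a b. B a b $ 1 $ 2);
         B21 = cell_values x y (\<lambda>a b. B a b $ 2 $ 1)
     in - (hbar\<^sup>2 / 2) *\<^sub>R
       (along_x (fdiff x) (\<lambda>j k. B11 j k *\<^sub>R along_x (bdiff x) W j k) j k
        + along_x (fdiff x) (along_y (favg y)
            (\<lambda>j k. B12 j k *\<^sub>R along_x bavg (along_y (bdiff y) W) j k)) j k
        + along_x (favg x) (along_y (fdiff y)
            (\<lambda>j k. B21 j k *\<^sub>R along_x (bdiff x) (along_y bavg W) j k)) j k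
        + along_y (fdiff y) (\<lambda>j k. B22 j k *\<^sub>R along_y (bdiff y) W j k) j k))"


definition inner_y :: "(nat \<Rightarrow> real) \<Rightarrow> nat \<Rightarrow> (nat \<Rightarrow> complex) \<Rightarrow> (nat \<Rightarrow> complex) \<Rightarrow> complex" where
  "inner_y y K U W = (\<Sum>k\<in>{1..<K}. U k * cnj (W k) * of_real (half_step y k))"

definition inner_xy ::
    "(nat \<Rightarrow> real) \<Rightarrow> (nat \<Rightarrow> real) \<Rightarrow> nat \<Rightarrow> nat
      \<Rightarrow> (nat \<Rightarrow> nat \<Rightarrow> complex) \<Rightarrow> (nat \<Rightarrow> nat \<Rightarrow> complex) \<Rightarrow> complex" where
  "inner_xy x y J K U W =
     (\<Sum>j\<in>{1..<J}. \<Sum>k\<in>{1..<K}.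
        U j k * cnj (W j k) * of_real (half_step x j) * of_real (half_step y k))
     + (\<Sum>k\<in>{1..<K}.
        U J k * cnj (W J k) * of_real (mesh_step x J / 2) * of_real (half_step y k))"

text \<open>For increasing nodes \<open>inner_xy x y J K W W\<close> is real and nonnegative.\<close>

definition norm_xy ::
    "(nat \<Rightarrow> real) \<Rightarrow> (nat \<Rightarrow> real) \<Rightarrow> nat \<Rightarrow> nat \<Rightarrow> (nat \<Rightarrow> nat \<Rightarrow> complex) \<Rightarrow> real" where
  "norm_xy x y J K W = sqrt (Re (inner_xy x y J K W W))"


text \<open>Vanishing on the part of the mesh boundary lying on \<open>x = 0\<close>, \<open>y = 0\<close> and \<open>y = Y\<close>.\<close>

definition vanishes_on_Gamma :: "nat \<Rightarrow> nat \<Rightarrow> (nat \<Rightarrow> nat \<Rightarrow> complex) \<Rightarrow> bool" where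
  "vanishes_on_Gamma J K W \<longleftrightarrow>
     (\<forall>k\<in>{1..<K}. W 0 k = 0) \<and> (\<forall>j\<le>J. W j 0 = 0 \<and> W j K = 0)"

datatype splitting_variant = Cayley | Exponential

definition splitting_factor ::
    "splitting_variant \<Rightarrow> real \<Rightarrow> real \<Rightarrow> real \<Rightarrow> real \<Rightarrow> complex" where
  "splitting_factor v hbar \<tau> r dV = (case v of
     Cayley \<Rightarrow> (1 - \<i> * of_real (\<tau> / (4 * hbar * r) * dV)) / (1 + \<i> * of_real (\<tau> / (4 * hbar * r) * dV))
   | Exponential \<Rightarrow> exp (- \<i> * of_real (\<tau> / (2 * hbar * r) * dV)))"

text \<open>
  A linear operator from functions \<open>\<Phi> l k\<close> with \<open>1 \<le> l \<le> m\<close>, \<open>1 \<le> k \<le> K - 1\<close> to functions of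
  \<open>1 \<le> k \<le> K - 1\<close>.  Since HOL functions are total, the first conjunct expresses that the operator
  sees only these values of its argument.
\<close>

definition linear_mesh_operator ::
    "nat \<Rightarrow> nat \<Rightarrow> ((nat \<Rightarrow> nat \<Rightarrow> complex) \<Rightarrow> nat \<Rightarrow> complex) \<Rightarrow> bool" where
  "linear_mesh_operator K m T \<longleftrightarrow>
     (\<forall>\<Phi> \<Phi>'. (\<forall>l\<in>{1..m}. \<forall>k\<in>{1..<K}. \<Phi> l k = \<Phi>' l k) \<longrightarrow> (\<forall>k\<in>{1..<K}. T \<Phi> k = T \<Phi>' k)) \<and>
     (\<forall>\<Phi> \<Phi>'. \<forall>k\<in>{1..<K}. T (\<lambda>l k. \<Phi> l k + \<Phi>' l k) k = T \<Phi> k + T \<Phi>' k) \<and>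
     (\<forall>c \<Phi>. \<forall>k\<in>{1..<K}. T (\<lambda>l k. c * \<Phi> l k) k = c * T \<Phi> k)"

end

theory Submission
  imports Defs
begin

text \<open>
  The bound is an energy estimate.  Write \<open>N\<close> for the norm weighted by \<open>sqrt \<rho>\<close>.  The two
  splitting factors have modulus one (\<open>norm_splitting_factor\<close>), so multiplication by them does not
  change \<open>N\<close>, and all variation of \<open>N\<close> over a time step comes from the Crank--Nicolson stage
  between \<open>\<Psi>b\<close> and \<open>\<Psi>t\<close>.  Multiply that stage by the conjugate of the average
  \<open>W = (\<Psi>t + \<Psi>b) / 2\<close>, sum over the mesh and take imaginary parts.  The left-hand side becomes
  the increment of \<open>N\<^sup>2\<close>.  On the right the Hamiltonian is symmetric up to what its summation by
  parts leaves on the artificial boundary \<open>x = X\<close>, namely the flux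
  \<open>hbar\<^sup>2 / 2 * B1inf * bdiff x W J\<close> (\<open>Im_mesh_hamiltonian\<close>).  The transparent boundary condition
  is an equation for the half cell at \<open>x = X\<close> containing exactly this flux.  Adding it, with the
  half-cell weight that the inner product already uses, replaces the flux by \<open>S\<close>, and all that
  remains is the work of \<open>F\<close> and the term \<open>Im (S \<Psi>t, W)\<close> on the boundary (\<open>energy_balance\<close>).

  Beyond \<open>X0\<close> the potentials \<open>V\<close> and \<open>Vt\<close> agree, so on the column \<open>j = J\<close> the splitting factor is
  one and \<open>\<Psi>b\<close> there is the previous \<open>\<Psi>t\<close>.  Hence \<open>W\<close> on this column is the time average of the
  single sequence \<open>\<Psi>t\<close>, started from \<open>0\<close>, and the hypothesis on \<open>S\<close> says that the accumulated
  boundary terms can only decrease \<open>N\<^sup>2\<close>.  Bounding the work of \<open>F\<close> by Cauchy--Schwarz gives a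
  quadratic inequality for the values of \<open>N\<close>, which is divided by their maximum
  (\<open>Max_le_of_quadratic_bound\<close>).
\<close>

section \<open>Summation by parts on a one-dimensional mesh\<close>

lemma Im_of_real_mult: "Im (of_real c * z) = c * Im z"
  by simp

lemma half_step_pos:
  assumes "mesh_step z n > 0" "mesh_step z (n + 1) > 0"
  shows "half_step z n > 0"
  using assms by (simp add: half_step_def)

lemma favg_eq_const:
  assumes "mesh_step z n > 0" "mesh_step z (n + 1) > 0" "G n = c" "G (n + 1) = c"
  shows "favg z G n = (c :: real)"
  using assms by (simp add: favg_def half_step_def field_simps)

lemma favg_pos:
  assumes "mesh_step z n > 0" "mesh_step z (n + 1) > 0" "G n > 0" "G (n + 1) > 0"
  shows "favg z G n > (0 :: real)"
  using assms by (simp add: favg_def half_step_def add_pos_pos)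

text \<open>
  The weights \<open>half_step\<close> and \<open>mesh_step\<close> cancel the denominators of \<open>fdiff\<close> and \<open>bdiff\<close>, so this is
  Abel summation on a nonuniform mesh.  The sums on the two sides have different ranges because
  \<open>fdiff\<close> lives on the interior nodes and \<open>bdiff\<close> on the cells.
\<close>

lemma sum_fdiff_by_parts:
  fixes G c :: "nat \<Rightarrow> complex"
  assumes "n \<ge> 1" "\<And>j. j \<in> {1..n} \<Longrightarrow> mesh_step z j > 0"
  shows "(\<Sum>j\<in>{1..<n}. of_real (half_step z j) * fdiff z G j * c j)
       = G n * c n - G 1 * c 0 - (\<Sum>j\<in>{1..n}. of_real (mesh_step z j) * G j * bdiff z c j)"
    (is "?D n = _ - ?E n")
  using assms
proof (induction n rule: nat_induct_at_least)
  case base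
  then have "mesh_step z 1 \<noteq> 0" by force
  then show ?case by (simp add: bdiff_def scaleR_conv_of_real algebra_simps)
next
  case (Suc n)
  have p: "mesh_step z n > 0" "mesh_step z (n + 1) > 0" using Suc.prems Suc.hyps by auto
  then have "half_step z n > 0" by (rule half_step_pos)
  then have "of_real (half_step z n) * fdiff z G n = G (n + 1) - G n"
    by (simp add: fdiff_def scaleR_conv_of_real)
  moreover have "of_real (mesh_step z (Suc n)) * G (Suc n) * bdiff z c (Suc n)
      = G (Suc n) * (c (Suc n) - c n)"
    using p by (simp add: bdiff_def scaleR_conv_of_real)
  ultimately have D: "?D (Suc n) = ?D n + (G (n + 1) - G n) * c n"
      and E: "?E (Suc n) = ?E n + G (Suc n) * (c (Suc n) - c n)"
    using Suc.hyps by simp_all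
  show ?case unfolding D E using Suc.IH Suc.prems by (simp add: algebra_simps)
qed

text \<open>
  Both sums distribute half of each cell's \<open>mesh_step z j * G j\<close> to the two ends of the cell.  The
  left-hand side runs over interior nodes only, so the shares of the nodes \<open>0\<close> and \<open>n\<close> are subtracted.
\<close>

lemma sum_favg_by_parts:
  fixes G c :: "nat \<Rightarrow> complex"
  assumes "n \<ge> 1" "\<And>j. j \<in> {1..n} \<Longrightarrow> mesh_step z j > 0"
  shows "(\<Sum>j\<in>{1..<n}. of_real (half_step z j) * favg z G j * c j)
       = (\<Sum>j\<in>{1..n}. of_real (mesh_step z j) * G j * bavg c j)
         - (of_real (mesh_step z 1) * G 1 * c 0 + of_real (mesh_step z n) * G n * c n) / 2"
    (is "?D n = ?E n - _")
  using assms
proof (induction n rule: nat_induct_at_least)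
  case base
  then show ?case by (simp add: bavg_def scaleR_conv_of_real field_simps)
next
  case (Suc n)
  have p: "mesh_step z n > 0" "mesh_step z (n + 1) > 0" using Suc.prems Suc.hyps by auto
  then have "half_step z n > 0" by (rule half_step_pos)
  then have "of_real (half_step z n) * favg z G n
      = (of_real (mesh_step z n) * G n + of_real (mesh_step z (Suc n)) * G (Suc n)) / 2"
    by (simp add: favg_def scaleR_conv_of_real)
  moreover have "bavg c (Suc n) = (c n + c (Suc n)) / 2"
    by (simp add: bavg_def scaleR_conv_of_real)
  ultimately have D: "?D (Suc n) = ?D n
        + (of_real (mesh_step z n) * G n + of_real (mesh_step z (Suc n)) * G (Suc n)) / 2 * c n"
      and E: "?E (Suc n) = ?E n + of_real (mesh_step z (Suc n)) * G (Suc n) * ((c n + c (Suc n)) / 2)"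
    using Suc.hyps by (simp_all add: mult.assoc)
  show ?case unfolding D E using Suc.IH Suc.prems by (simp add: add_divide_distrib algebra_simps)
qed

lemma bdiff_cnj: "bdiff z (\<lambda>j. cnj (w j)) n = cnj (bdiff z w n)"
  by (simp add: bdiff_def)

lemma bavg_cnj: "bavg (\<lambda>j. cnj (w j)) n = cnj (bavg w n)"
  by (simp add: bavg_def)

lemma bavg_bdiff_commute:
  "bavg (\<lambda>k. bdiff z (\<lambda>j. W j k) a) b = bdiff z (\<lambda>j. bavg (W j) b) a"
  by (simp add: bavg_def bdiff_def scaleR_diff_right scaleR_add_right algebra_simps)

text \<open>
  A real coefficient makes the sum of \<open>b * cmod (bdiff w)\<^sup>2\<close> over the cells real, which leaves only
  the flux at the right end; it vanishes as well when \<open>w n = 0\<close>.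
\<close>

lemma Im_sum_second_difference:
  fixes w :: "nat \<Rightarrow> complex"
  assumes "n \<ge> 1" "\<And>j. j \<in> {1..n} \<Longrightarrow> mesh_step z j > 0" "w 0 = 0"
  shows "Im (\<Sum>j\<in>{1..<n}. of_real (half_step z j) * fdiff z (\<lambda>j. b j *\<^sub>R bdiff z w j) j * cnj (w j))
       = Im (b n *\<^sub>R bdiff z w n * cnj (w n))"
proof -
  have "Im (\<Sum>j\<in>{1..n}. of_real (mesh_step z j) * (b j *\<^sub>R bdiff z w j) * cnj (bdiff z w j)) = 0"
    by (simp add: Im_sum)
  then show ?thesis
    using sum_fdiff_by_parts[OF assms(1,2), where G = "\<lambda>j. b j *\<^sub>R bdiff z w j" and c = "\<lambda>j. cnj (w j)"] assms(3)
    by (simp add: bdiff_cnj)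
qed

section \<open>Mixed differences on the rectangular mesh\<close>

locale space_mesh =
  fixes x y :: "nat \<Rightarrow> real" and J K :: nat
  assumes J: "J \<ge> 1" "\<And>j. j \<in> {1..J} \<Longrightarrow> mesh_step x j > 0"
    and K: "K \<ge> 1" "\<And>k. k \<in> {1..K} \<Longrightarrow> mesh_step y k > 0"
begin

text \<open>
  The next two lemmas move the differences and averages of a mixed term onto the test function,
  first in \<open>x\<close>, then in \<open>y\<close>.  In \<open>x\<close> the test function vanishes only at the left end, so the
  coefficient field has to vanish on the last column of cells.
\<close>

lemma sum_fdiff_favg_by_parts:
  fixes P C :: "nat \<Rightarrow> nat \<Rightarrow> complex"
  assumes P: "\<And>k. k \<in> {1..K} \<Longrightarrow> P J k = 0"
    and C: "\<And>k. k \<in> {1..<K} \<Longrightarrow> C 0 k = 0" "\<And>j. j \<le> J \<Longrightarrow> C j 0 = 0" "\<And>j. j \<le> J \<Longrightarrow> C j K = 0"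
  shows "(\<Sum>j\<in>{1..<J}. \<Sum>k\<in>{1..<K}. of_real (half_step x j) * of_real (half_step y k)
             * fdiff x (\<lambda>j. favg y (P j) k) j * C j k)
       = - (\<Sum>j\<in>{1..J}. \<Sum>k\<in>{1..K}. of_real (mesh_step x j) * of_real (mesh_step y k)
             * P j k * bdiff x (\<lambda>j. bavg (C j) k) j)"
proof -
  have x_parts: "(\<Sum>j\<in>{1..<J}. of_real (half_step x j) * fdiff x (\<lambda>j. favg y (P j) k) j * C j k)
      = - (\<Sum>j\<in>{1..J}. of_real (mesh_step x j) * favg y (P j) k * bdiff x (\<lambda>j. C j k) j)"
    if "k \<in> {1..<K}" for k
  proof -
    have "favg y (P J) k = 0" using that P by (simp add: favg_def)
    then show ?thesis
      using sum_fdiff_by_parts[OF J, where G = "\<lambda>j. favg y (P j) k" and c = "\<lambda>j. C j k"] C(1)[OF that] by simp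
  qed
  have y_parts: "(\<Sum>k\<in>{1..<K}. of_real (half_step y k) * favg y (P j) k * bdiff x (\<lambda>j. C j k) j)
      = (\<Sum>k\<in>{1..K}. of_real (mesh_step y k) * P j k * bdiff x (\<lambda>j. bavg (C j) k) j)"
    if "j \<in> {1..J}" for j
  proof -
    have "bdiff x (\<lambda>j. C j 0) j = 0" "bdiff x (\<lambda>j. C j K) j = 0"
      using that C(2,3) by (auto simp: bdiff_def)
    then show ?thesis
      using sum_favg_by_parts[OF K, where G = "P j" and c = "\<lambda>k. bdiff x (\<lambda>j. C j k) j"]
      by (simp add: bavg_bdiff_commute)
  qed
  have "(\<Sum>j\<in>{1..<J}. \<Sum>k\<in>{1..<K}. of_real (half_step x j) * of_real (half_step y k)
             * fdiff x (\<lambda>j. favg y (P j) k) j * C j k)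
      = (\<Sum>k\<in>{1..<K}. of_real (half_step y k) * (\<Sum>j\<in>{1..<J}.
             of_real (half_step x j) * fdiff x (\<lambda>j. favg y (P j) k) j * C j k))"
    by (subst sum.swap) (simp add: sum_distrib_left mult_ac)
  also have "\<dots> = - (\<Sum>k\<in>{1..<K}. \<Sum>j\<in>{1..J}. of_real (half_step y k) *
             (of_real (mesh_step x j) * favg y (P j) k * bdiff x (\<lambda>j. C j k) j))"
    using x_parts by (simp add: sum_distrib_left sum_negf)
  also have "\<dots> = - (\<Sum>j\<in>{1..J}. of_real (mesh_step x j) * (\<Sum>k\<in>{1..<K}.
             of_real (half_step y k) * favg y (P j) k * bdiff x (\<lambda>j. C j k) j))"
    by (subst sum.swap) (simp add: sum_distrib_left mult_ac)
  also have "\<dots> = - (\<Sum>j\<in>{1..J}. of_real (mesh_step x j) * (\<Sum>k\<in>{1..K}.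
             of_real (mesh_step y k) * P j k * bdiff x (\<lambda>j. bavg (C j) k) j))"
    using y_parts by simp
  finally show ?thesis by (simp add: sum_distrib_left mult_ac)
qed

lemma sum_favg_fdiff_by_parts:
  fixes Q C :: "nat \<Rightarrow> nat \<Rightarrow> complex"
  assumes Q: "\<And>k. k \<in> {1..K} \<Longrightarrow> Q J k = 0"
    and C: "\<And>k. k \<in> {1..<K} \<Longrightarrow> C 0 k = 0" "\<And>j. j \<le> J \<Longrightarrow> C j 0 = 0" "\<And>j. j \<le> J \<Longrightarrow> C j K = 0"
  shows "(\<Sum>j\<in>{1..<J}. \<Sum>k\<in>{1..<K}. of_real (half_step x j) * of_real (half_step y k)
             * favg x (\<lambda>j. fdiff y (Q j) k) j * C j k)
       = - (\<Sum>j\<in>{1..J}. \<Sum>k\<in>{1..K}. of_real (mesh_step x j) * of_real (mesh_step y k)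
             * Q j k * bavg (\<lambda>j. bdiff y (C j) k) j)"
proof -
  have x_parts: "(\<Sum>j\<in>{1..<J}. of_real (half_step x j) * favg x (\<lambda>j. fdiff y (Q j) k) j * C j k)
      = (\<Sum>j\<in>{1..J}. of_real (mesh_step x j) * fdiff y (Q j) k * bavg (\<lambda>j. C j k) j)"
    if "k \<in> {1..<K}" for k
  proof -
    have "fdiff y (Q J) k = 0" using that Q by (simp add: fdiff_def)
    then show ?thesis
      using sum_favg_by_parts[OF J, where G = "\<lambda>j. fdiff y (Q j) k" and c = "\<lambda>j. C j k"] C(1)[OF that] by simp
  qed
  have y_parts: "(\<Sum>k\<in>{1..<K}. of_real (half_step y k) * fdiff y (Q j) k * bavg (\<lambda>j. C j k) j)
      = - (\<Sum>k\<in>{1..K}. of_real (mesh_step y k) * Q j k * bavg (\<lambda>j. bdiff y (C j) k) j)"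
    if "j \<in> {1..J}" for j
  proof -
    have "bavg (\<lambda>j. C j 0) j = 0" "bavg (\<lambda>j. C j K) j = 0"
      using that C(2,3) by (auto simp: bavg_def)
    then show ?thesis
      using sum_fdiff_by_parts[OF K, where G = "Q j" and c = "\<lambda>k. bavg (\<lambda>j. C j k) j"]
      by (simp add: bavg_bdiff_commute[of y "\<lambda>k j. C j k"])
  qed
  have "(\<Sum>j\<in>{1..<J}. \<Sum>k\<in>{1..<K}. of_real (half_step x j) * of_real (half_step y k)
             * favg x (\<lambda>j. fdiff y (Q j) k) j * C j k)
      = (\<Sum>k\<in>{1..<K}. of_real (half_step y k) * (\<Sum>j\<in>{1..<J}.
             of_real (half_step x j) * favg x (\<lambda>j. fdiff y (Q j) k) j * C j k))"
    by (subst sum.swap) (simp add: sum_distrib_left mult_ac)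
  also have "\<dots> = (\<Sum>k\<in>{1..<K}. \<Sum>j\<in>{1..J}. of_real (half_step y k) *
             (of_real (mesh_step x j) * fdiff y (Q j) k * bavg (\<lambda>j. C j k) j))"
    using x_parts by (simp add: sum_distrib_left)
  also have "\<dots> = (\<Sum>j\<in>{1..J}. of_real (mesh_step x j) * (\<Sum>k\<in>{1..<K}.
             of_real (half_step y k) * fdiff y (Q j) k * bavg (\<lambda>j. C j k) j))"
    by (subst sum.swap) (simp add: sum_distrib_left mult_ac)
  also have "\<dots> = - (\<Sum>j\<in>{1..J}. of_real (mesh_step x j) * (\<Sum>k\<in>{1..K}.
             of_real (mesh_step y k) * Q j k * bavg (\<lambda>j. bdiff y (C j) k) j))"
    using y_parts by (simp add: sum_negf)
  finally show ?thesis by (simp add: sum_distrib_left mult_ac)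
qed

text \<open>
  Neither mixed term is symmetric alone.  Summation by parts turns them into sums over the cells that
  are complex conjugates of each other when \<open>b = b'\<close>, so their total is real.
\<close>

lemma Im_mixed_differences:
  fixes W :: "nat \<Rightarrow> nat \<Rightarrow> complex" and b :: "nat \<Rightarrow> nat \<Rightarrow> real"
  assumes b: "\<And>k. k \<in> {1..K} \<Longrightarrow> b J k = 0"
    and b': "\<And>j k. j \<in> {1..J} \<Longrightarrow> k \<in> {1..K} \<Longrightarrow> b' j k = b j k"
    and W: "vanishes_on_Gamma J K W"
  shows "Im (\<Sum>j\<in>{1..<J}. \<Sum>k\<in>{1..<K}. of_real (half_step x j) * of_real (half_step y k)
             * (fdiff x (\<lambda>j. favg y (\<lambda>k. b j k *\<^sub>R bavg (\<lambda>j. bdiff y (W j) k) j) k) j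
                + favg x (\<lambda>j. fdiff y (\<lambda>k. b' j k *\<^sub>R bdiff x (\<lambda>j. bavg (W j) k) j) k) j) * cnj (W j k)) = 0"
proof -
  define Z where "Z = (\<Sum>j\<in>{1..J}. \<Sum>k\<in>{1..K}. of_real (mesh_step x j) * of_real (mesh_step y k)
             * (b j k *\<^sub>R bavg (\<lambda>j. bdiff y (W j) k) j) * cnj (bdiff x (\<lambda>j. bavg (W j) k) j))"
  define P where "P = (\<lambda>j k. b j k *\<^sub>R bavg (\<lambda>j. bdiff y (W j) k) j)"
  define Q where "Q = (\<lambda>j k. b' j k *\<^sub>R bdiff x (\<lambda>j. bavg (W j) k) j)"
  have C: "\<And>k. k \<in> {1..<K} \<Longrightarrow> cnj (W 0 k) = 0" "\<And>j. j \<le> J \<Longrightarrow> cnj (W j 0) = 0"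
      "\<And>j. j \<le> J \<Longrightarrow> cnj (W j K) = 0"
    using W by (auto simp: vanishes_on_Gamma_def)
  have 1: "(\<Sum>j\<in>{1..<J}. \<Sum>k\<in>{1..<K}. of_real (half_step x j) * of_real (half_step y k)
             * fdiff x (\<lambda>j. favg y (P j) k) j * cnj (W j k)) = - Z"
  proof -
    have "\<And>k. k \<in> {1..K} \<Longrightarrow> P J k = 0" using b by (simp add: P_def)
    from sum_fdiff_favg_by_parts[where P = P and C = "\<lambda>j k. cnj (W j k)", OF this C] show ?thesis
      by (simp add: Z_def P_def bavg_cnj bdiff_cnj)
  qed
  have 2: "(\<Sum>j\<in>{1..<J}. \<Sum>k\<in>{1..<K}. of_real (half_step x j) * of_real (half_step y k)
             * favg x (\<lambda>j. fdiff y (Q j) k) j * cnj (W j k)) = - cnj Z"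
  proof -
    have "\<And>k. k \<in> {1..K} \<Longrightarrow> Q J k = 0" using b b' J(1) by (simp add: Q_def)
    from sum_favg_fdiff_by_parts[where Q = Q and C = "\<lambda>j k. cnj (W j k)", OF this C] show ?thesis
      by (auto simp: Z_def Q_def bavg_cnj bdiff_cnj b' mult_ac intro!: sum.cong)
  qed
  show ?thesis
    using arg_cong2[OF 1 2, of "\<lambda>u v. Im (u + v)"]
    unfolding P_def Q_def by (simp add: sum.distrib[symmetric] algebra_simps)
qed


section \<open>Weighted inner product and norm\<close>

lemma half_step_x_pos: "j \<in> {1..<J} \<Longrightarrow> half_step x j > 0"
  by (intro half_step_pos J) auto

lemma half_step_y_pos: "k \<in> {1..<K} \<Longrightarrow> half_step y k > 0"
  by (intro half_step_pos K) auto

text \<open>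
  The column \<open>J\<close> is weighted by its half cell to the left, which lets \<open>inner_xy\<close> be treated as one
  weighted sum over all nodes.
\<close>

definition node_weight :: "nat \<Rightarrow> nat \<Rightarrow> real" where
  "node_weight j k = (if j < J then half_step x j else mesh_step x J / 2) * half_step y k"

lemma node_weight_pos: "j \<in> {1..J} \<Longrightarrow> k \<in> {1..<K} \<Longrightarrow> node_weight j k > 0"
  using J half_step_x_pos[of j] half_step_y_pos[of k] by (auto simp: node_weight_def)

lemma inner_xy_eq_sum:
  "inner_xy x y J K U W
     = (\<Sum>j\<in>{1..J}. \<Sum>k\<in>{1..<K}. of_real (node_weight j k) * (U j k * cnj (W j k)))"
proof -
  have split: "{1..J} = insert J {1..<J}" using J by auto
  show ?thesis
    unfolding inner_xy_def split node_weight_def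
    by (simp add: add.commute mult_ac)
qed

lemma norm_xy_eq_sum:
  "norm_xy x y J K U = sqrt (\<Sum>j\<in>{1..J}. \<Sum>k\<in>{1..<K}. node_weight j k * (cmod (U j k))\<^sup>2)"
  unfolding norm_xy_def inner_xy_eq_sum by (simp add: complex_mult_cnj cmod_power2)

text \<open>The triangle and Cauchy--Schwarz inequalities below are inherited from \<^const>\<open>L2_set\<close>.\<close>

lemma norm_xy_eq_L2_set:
  "norm_xy x y J K U
     = L2_set (\<lambda>(j, k). sqrt (node_weight j k) * cmod (U j k)) ({1..J} \<times> {1..<K})"
  unfolding norm_xy_eq_sum L2_set_def sum.cartesian_product
  using node_weight_pos
  by (auto intro!: arg_cong[where f = sqrt] sum.cong simp: power_mult_distrib less_imp_le)

lemma norm_xy_nonneg: "norm_xy x y J K U \<ge> 0"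
  unfolding norm_xy_eq_L2_set by simp

lemma norm_xy_power2:
  "(norm_xy x y J K U)\<^sup>2 = (\<Sum>j\<in>{1..J}. \<Sum>k\<in>{1..<K}. node_weight j k * (cmod (U j k))\<^sup>2)"
  unfolding norm_xy_eq_sum
  using node_weight_pos by (intro real_sqrt_pow2 sum_nonneg) (auto simp: less_imp_le)

lemma norm_xy_cong_cmod:
  assumes "\<And>j k. j \<in> {1..J} \<Longrightarrow> k \<in> {1..<K} \<Longrightarrow> cmod (U j k) = cmod (W j k)"
  shows "norm_xy x y J K U = norm_xy x y J K W"
  unfolding norm_xy_eq_sum using assms by simp

lemma norm_xy_average_le:
  "norm_xy x y J K (\<lambda>j k. (U j k + W j k) / 2) \<le> (norm_xy x y J K U + norm_xy x y J K W) / 2"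
proof -
  let ?A = "{1..J} \<times> {1..<K}"
  define u where "u = (\<lambda>(j, k). sqrt (node_weight j k) * cmod (U j k))"
  define w where "w = (\<lambda>(j, k). sqrt (node_weight j k) * cmod (W j k))"
  have "norm_xy x y J K (\<lambda>j k. (U j k + W j k) / 2) \<le> L2_set (\<lambda>p. 1/2 * (u p + w p)) ?A"
    unfolding norm_xy_eq_L2_set u_def w_def
    using node_weight_pos
    by (intro L2_set_mono)
       (auto simp: norm_divide distrib_left[symmetric] less_imp_le intro!: mult_left_mono norm_triangle_ineq)
  also have "\<dots> = 1/2 * L2_set (\<lambda>p. u p + w p) ?A"
    by (rule L2_set_right_distrib[symmetric]) simp
  also have "\<dots> \<le> 1/2 * (L2_set u ?A + L2_set w ?A)"
    by (intro mult_left_mono L2_set_triangle_ineq) simp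
  finally show ?thesis by (simp add: norm_xy_eq_L2_set u_def w_def)
qed

lemma inner_xy_Cauchy_Schwarz:
  "cmod (inner_xy x y J K U W) \<le> norm_xy x y J K U * norm_xy x y J K W"
proof -
  let ?A = "{1..J} \<times> {1..<K}"
  have "cmod (inner_xy x y J K U W)
      \<le> (\<Sum>(j, k)\<in>?A. cmod (of_real (node_weight j k) * (U j k * cnj (W j k))))"
    unfolding inner_xy_eq_sum sum.cartesian_product
    by (rule order_trans[OF norm_sum]) (simp add: case_prod_unfold)
  also have "\<dots> = (\<Sum>p\<in>?A. \<bar>case p of (j, k) \<Rightarrow> sqrt (node_weight j k) * cmod (U j k)\<bar>
                         * \<bar>case p of (j, k) \<Rightarrow> sqrt (node_weight j k) * cmod (W j k)\<bar>)"
    using node_weight_pos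
    by (intro sum.cong) (auto simp: norm_mult abs_mult less_imp_le)
  also have "\<dots> \<le> norm_xy x y J K U * norm_xy x y J K W"
    unfolding norm_xy_eq_L2_set by (rule L2_set_mult_ineq)
  finally show ?thesis .
qed

section \<open>Energy balance of one time step\<close>

text \<open>
  The Hamiltonian fails to be symmetric only through the flux across the column \<open>J\<close>.  The mixed
  coefficient must vanish on the last column of cells for the mixed terms to contribute nothing there.
\<close>

lemma Im_mesh_hamiltonian:
  assumes W: "vanishes_on_Gamma J K W"
    and sym: "\<And>j k. j \<in> {1..J} \<Longrightarrow> k \<in> {1..K} \<Longrightarrow>
      B (midpoint1 x j) (midpoint1 y k) $ 2 $ 1 = B (midpoint1 x j) (midpoint1 y k) $ 1 $ 2"
    and B12: "\<And>k. k \<in> {1..K} \<Longrightarrow> B (midpoint1 x J) (midpoint1 y k) $ 1 $ 2 = 0"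
    and B11: "\<And>k. k \<in> {1..K} \<Longrightarrow> B (midpoint1 x J) (midpoint1 y k) $ 1 $ 1 = b1"
  shows "Im (\<Sum>j\<in>{1..<J}. \<Sum>k\<in>{1..<K}. of_real (half_step x j) * of_real (half_step y k)
               * mesh_hamiltonian hbar B x y W j k * cnj (W j k))
       = - Im (\<Sum>k\<in>{1..<K}. of_real (half_step y k)
               * (of_real (hbar\<^sup>2 / 2 * b1) * bdiff x (\<lambda>j. W j k) J * cnj (W J k)))"
proof -
  let ?b = "\<lambda>p q j k. cell_values x y (\<lambda>a b. B a b $ p $ q) j k"
  define b11 where "b11 j k = favg y (?b 1 1 j) k" for j k
  define b22 where "b22 j k = favg x (\<lambda>j. ?b 2 2 j k) j" for j k
  define D1 where "D1 j k = fdiff x (\<lambda>j. b11 j k *\<^sub>R bdiff x (\<lambda>j. W j k) j) j" for j k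
  define D2 where "D2 j k = fdiff y (\<lambda>k. b22 j k *\<^sub>R bdiff y (W j) k) k" for j k
  define M where "M j k =
      fdiff x (\<lambda>j. favg y (\<lambda>k. ?b 1 2 j k *\<^sub>R bavg (\<lambda>j. bdiff y (W j) k) j) k) j
      + favg x (\<lambda>j. fdiff y (\<lambda>k. ?b 2 1 j k *\<^sub>R bdiff x (\<lambda>j. bavg (W j) k) j) k) j" for j k
  let ?g = "\<lambda>f. \<Sum>j\<in>{1..<J}. \<Sum>k\<in>{1..<K}. of_real (half_step x j) * of_real (half_step y k)
               * f j k * cnj (W j k)"
  have H: "mesh_hamiltonian hbar B x y W j k
      = of_real (- (hbar\<^sup>2 / 2)) * (D1 j k + M j k + D2 j k)" for j k
    unfolding mesh_hamiltonian_def Let_def along_x_def along_y_def D1_def D2_def M_def b11_def b22_def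
    by (simp add: scaleR_conv_of_real add_ac)
  have "?g (mesh_hamiltonian hbar B x y W) = of_real (- (hbar\<^sup>2 / 2)) * (?g D1 + ?g M + ?g D2)"
  proof -
    have scale: "?g (\<lambda>j k. c * f j k) = c * ?g f" for f c
      by (simp add: sum_distrib_left mult_ac)
    have add: "?g (\<lambda>j k. D1 j k + M j k + D2 j k) = ?g D1 + ?g M + ?g D2"
      by (simp add: sum.distrib algebra_simps)
    show ?thesis unfolding H scale add ..
  qed
  then have g: "Im (?g (mesh_hamiltonian hbar B x y W))
      = - (hbar\<^sup>2 / 2) * (Im (?g D1) + Im (?g M) + Im (?g D2))"
    by simp
  have "Im (?g M) = 0"
    unfolding M_def
    using sym B12 by (intro Im_mixed_differences W) (auto simp: cell_values_def)
  moreover have "Im (?g D2) = 0"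
  proof -
    have "Im (\<Sum>k\<in>{1..<K}. of_real (half_step y k) * D2 j k * cnj (W j k)) = 0" if "j \<in> {1..<J}" for j
      using Im_sum_second_difference[OF K, where w = "W j" and b = "b22 j"] W that
      by (simp add: D2_def vanishes_on_Gamma_def)
    moreover have "?g D2 = (\<Sum>j\<in>{1..<J}. of_real (half_step x j) *
        (\<Sum>k\<in>{1..<K}. of_real (half_step y k) * D2 j k * cnj (W j k)))"
      by (simp add: sum_distrib_left mult_ac)
    ultimately show ?thesis by simp
  qed
  moreover have "Im (?g D1) = Im (\<Sum>k\<in>{1..<K}. of_real (half_step y k)
               * (of_real b1 * bdiff x (\<lambda>j. W j k) J * cnj (W J k)))"
  proof -
    have "Im (\<Sum>j\<in>{1..<J}. of_real (half_step x j) * D1 j k * cnj (W j k))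
        = Im (of_real b1 * bdiff x (\<lambda>j. W j k) J * cnj (W J k))" if k: "k \<in> {1..<K}" for k
    proof -
      have "b11 J k = b1"
        unfolding b11_def cell_values_def using k by (intro favg_eq_const K B11) auto
      then show ?thesis
        using Im_sum_second_difference[OF J, where w = "\<lambda>j. W j k" and b = "\<lambda>j. b11 j k"] W k
        by (simp add: D1_def vanishes_on_Gamma_def scaleR_conv_of_real)
    qed
    moreover have "?g D1 = (\<Sum>k\<in>{1..<K}. of_real (half_step y k) *
        (\<Sum>j\<in>{1..<J}. of_real (half_step x j) * D1 j k * cnj (W j k)))"
      by (subst sum.swap) (simp add: sum_distrib_left mult_ac)
    ultimately show ?thesis by simp
  qed
  ultimately have "Im (?g (mesh_hamiltonian hbar B x y W))
      = - (hbar\<^sup>2 / 2) * Im (\<Sum>k\<in>{1..<K}. of_real (half_step y k)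
               * (of_real b1 * bdiff x (\<lambda>j. W j k) J * cnj (W J k)))"
    using g by simp
  also have "\<dots> = - Im (of_real (hbar\<^sup>2 / 2) * (\<Sum>k\<in>{1..<K}. of_real (half_step y k)
               * (of_real b1 * bdiff x (\<lambda>j. W j k) J * cnj (W J k))))"
    by (simp only: Im_of_real_mult mult_minus_left)
  also have "\<dots> = - Im (\<Sum>k\<in>{1..<K}. of_real (half_step y k)
               * (of_real (hbar\<^sup>2 / 2 * b1) * bdiff x (\<lambda>j. W j k) J * cnj (W J k)))"
    by (simp only: sum_distrib_left of_real_mult mult_ac)
  finally show ?thesis .
qed

text \<open>The cross terms of \<open>(p - q) * cnj (p + q)\<close> are purely imaginary.\<close>

lemma Im_crank_nicolson:
  "Im (\<i> * of_real a * ((p - q) / of_real \<tau>) * cnj ((p + q) / 2))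
     = a / (2 * \<tau>) * ((cmod p)\<^sup>2 - (cmod q)\<^sup>2)"
proof -
  have "\<i> * of_real a * ((p - q) / of_real \<tau>) * cnj ((p + q) / 2)
      = of_real (a / (2 * \<tau>)) * (\<i> * ((p - q) * cnj (p + q)))"
    by (simp add: mult_ac)
  moreover have "Re ((p - q) * cnj (p + q)) = (cmod p)\<^sup>2 - (cmod q)\<^sup>2"
    unfolding cmod_power2 by (simp add: power2_eq_square algebra_simps)
  ultimately show ?thesis by (simp only: Im_of_real_mult Im_i_times)
qed

text \<open>
  The interior equations are tested with \<open>W\<close> and the weight of a full cell, the boundary equations
  with \<open>W\<close> on the column \<open>J\<close>; the factor \<open>mesh_step x J / 2\<close> that they carry is the missing part of
  the weight there.  The flux in them cancels the one produced by the Hamiltonian, and potentials and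
  the second difference in \<open>y\<close> along the column \<open>J\<close> give real numbers.
\<close>

lemma energy_balance:
  fixes Pt Pb F :: "nat \<Rightarrow> nat \<Rightarrow> complex" and s :: "nat \<Rightarrow> complex"
    and r :: "nat \<Rightarrow> nat \<Rightarrow> real"
  defines "W \<equiv> \<lambda>j k. (Pt j k + Pb j k) / 2"
  assumes pos: "hbar > 0" "\<tau> > 0" "\<And>j k. j \<in> {1..J} \<Longrightarrow> k \<in> {1..<K} \<Longrightarrow> r j k > 0"
    and Gamma: "vanishes_on_Gamma J K Pt" "vanishes_on_Gamma J K Pb"
    and sym: "\<And>j k. j \<in> {1..J} \<Longrightarrow> k \<in> {1..K} \<Longrightarrow>
      B (midpoint1 x j) (midpoint1 y k) $ 2 $ 1 = B (midpoint1 x j) (midpoint1 y k) $ 1 $ 2"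
    and B12: "\<And>k. k \<in> {1..K} \<Longrightarrow> B (midpoint1 x J) (midpoint1 y k) $ 1 $ 2 = 0"
    and B11: "\<And>k. k \<in> {1..K} \<Longrightarrow> B (midpoint1 x J) (midpoint1 y k) $ 1 $ 1 = b1"
    and r: "\<And>k. k \<in> {1..<K} \<Longrightarrow> r J k = rinf"
    and interior: "\<And>j k. j \<in> {1..<J} \<Longrightarrow> k \<in> {1..<K} \<Longrightarrow>
      \<i> * of_real (hbar * r j k) * ((Pt j k - Pb j k) / of_real \<tau>)
      = mesh_hamiltonian hbar B x y W j k + of_real (vt j) * W j k + F j k"
    and boundary: "\<And>k. k \<in> {1..<K} \<Longrightarrow>
      of_real (hbar\<^sup>2 / 2 * b1) * along_x (bdiff x) W J k
      - of_real (mesh_step x J / 2) *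
          (\<i> * of_real (hbar * rinf) * ((Pt J k - Pb J k) / of_real \<tau>)
           + (of_real (hbar\<^sup>2 / 2 * b2) * along_y (fdiff y) (along_y (bdiff y) W) J k
              - of_real vinf * W J k))
      + of_real (mesh_step x J / 2) * F J k
      = of_real (hbar\<^sup>2 / 2 * b1) * s k"
  shows "(norm_xy x y J K (\<lambda>j k. of_real (sqrt (r j k)) * Pt j k))\<^sup>2
       = (norm_xy x y J K (\<lambda>j k. of_real (sqrt (r j k)) * Pb j k))\<^sup>2
         + 2 * \<tau> / hbar * (Im (inner_xy x y J K F W) - hbar\<^sup>2 / 2 * b1 * Im (inner_y y K s (W J)))"
proof -
  define D where "D = (\<lambda>j k. \<i> * of_real (hbar * r j k) * ((Pt j k - Pb j k) / of_real \<tau>))"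
  have W: "vanishes_on_Gamma J K W"
    using Gamma by (auto simp: vanishes_on_Gamma_def W_def)
  have "Im (inner_xy x y J K D W) = (\<Sum>j\<in>{1..J}. \<Sum>k\<in>{1..<K}.
      node_weight j k * (hbar * r j k / (2 * \<tau>) * ((cmod (Pt j k))\<^sup>2 - (cmod (Pb j k))\<^sup>2)))"
    unfolding inner_xy_eq_sum Im_sum Im_of_real_mult
    by (simp only: D_def W_def Im_crank_nicolson)
  also have "\<dots> = hbar / (2 * \<tau>) *
      ((norm_xy x y J K (\<lambda>j k. of_real (sqrt (r j k)) * Pt j k))\<^sup>2
       - (norm_xy x y J K (\<lambda>j k. of_real (sqrt (r j k)) * Pb j k))\<^sup>2)"
  proof -
    have "(cmod (of_real (sqrt (r j k)) * z))\<^sup>2 = r j k * (cmod z)\<^sup>2"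
      if "j \<in> {1..J}" "k \<in> {1..<K}" for j k z
      using pos(3)[OF that] by (simp add: norm_mult power_mult_distrib)
    then show ?thesis
      unfolding norm_xy_power2 sum_subtractf[symmetric] sum_distrib_left
      by (intro sum.cong refl) (simp add: algebra_simps)
  qed
  finally have mass: "Im (inner_xy x y J K D W) = \<dots>" .

  \<comment> \<open>The trivial coefficient \<open>1\<close> puts the second difference into the form of
    \<open>Im_sum_second_difference\<close>.\<close>
  define L where "L = (\<lambda>k. fdiff y (\<lambda>k. 1 *\<^sub>R bdiff y (W J) k) k)"
  \<comment> \<open>The boundary condition, solved for the time difference on the half cell.\<close>
  have D_J: "D J k * of_real (mesh_step x J / 2)
      = of_real (hbar\<^sup>2 / 2 * b1) * bdiff x (\<lambda>j. W j k) J + of_real (mesh_step x J / 2) * F J k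
        + of_real (mesh_step x J / 2 * vinf) * W J k - of_real (hbar\<^sup>2 / 2 * b1) * s k
        - of_real (mesh_step x J / 2 * (hbar\<^sup>2 / 2 * b2)) * L k"
    if "k \<in> {1..<K}" for k
  proof -
    have solve: "d * h = a + h * f + h * v * w - c - h * q * l"
      if "a - h * (d + (q * l - v * w)) + h * f = c" for a c d f h l q v w :: complex
      unfolding that[symmetric] by (simp add: algebra_simps)
    have "of_real (hbar\<^sup>2 / 2 * b1) * bdiff x (\<lambda>j. W j k) J
        - of_real (mesh_step x J / 2) *
            (D J k + (of_real (hbar\<^sup>2 / 2 * b2) * L k - of_real vinf * W J k))
        + of_real (mesh_step x J / 2) * F J k
        = of_real (hbar\<^sup>2 / 2 * b1) * s k"
      using boundary[OF that] r[OF that] unfolding D_def L_def along_x_def along_y_def by simp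
    from solve[OF this] show ?thesis by (simp only: of_real_mult)
  qed
  have "inner_xy x y J K D W
      = (\<Sum>j\<in>{1..<J}. \<Sum>k\<in>{1..<K}.
           of_real (half_step x j) * of_real (half_step y k)
             * mesh_hamiltonian hbar B x y W j k * cnj (W j k)
           + of_real (half_step x j * half_step y k * vt j) * (W j k * cnj (W j k))
           + F j k * cnj (W j k) * of_real (half_step x j) * of_real (half_step y k))
        + (\<Sum>k\<in>{1..<K}.
             of_real (half_step y k) * (of_real (hbar\<^sup>2 / 2 * b1) * bdiff x (\<lambda>j. W j k) J * cnj (W J k))
             + F J k * cnj (W J k) * of_real (mesh_step x J / 2) * of_real (half_step y k)
             + of_real (mesh_step x J / 2 * vinf * half_step y k) * (W J k * cnj (W J k))
             - of_real (hbar\<^sup>2 / 2 * b1) * (s k * cnj (W J k) * of_real (half_step y k))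
             - of_real (mesh_step x J / 2 * (hbar\<^sup>2 / 2 * b2)) * (of_real (half_step y k) * L k * cnj (W J k)))"
    unfolding inner_xy_def
  proof (intro arg_cong2[where f = plus] sum.cong refl)
    fix j k assume "j \<in> {1..<J}" "k \<in> {1..<K}"
    then have D_jk: "D j k = mesh_hamiltonian hbar B x y W j k + of_real (vt j) * W j k + F j k"
      using interior by (simp add: D_def)
    show "D j k * cnj (W j k) * of_real (half_step x j) * of_real (half_step y k)
      = of_real (half_step x j) * of_real (half_step y k) * mesh_hamiltonian hbar B x y W j k * cnj (W j k)
           + of_real (half_step x j * half_step y k * vt j) * (W j k * cnj (W j k))
           + F j k * cnj (W j k) * of_real (half_step x j) * of_real (half_step y k)"
      unfolding D_jk by (simp add: algebra_simps)
  next
    fix k assume k: "k \<in> {1..<K}"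
    have "D J k * cnj (W J k) * of_real (mesh_step x J / 2) * of_real (half_step y k)
        = (D J k * of_real (mesh_step x J / 2)) * (cnj (W J k) * of_real (half_step y k))"
      by (simp only: mult_ac)
    then show "D J k * cnj (W J k) * of_real (mesh_step x J / 2) * of_real (half_step y k)
      = of_real (half_step y k) * (of_real (hbar\<^sup>2 / 2 * b1) * bdiff x (\<lambda>j. W j k) J * cnj (W J k))
             + F J k * cnj (W J k) * of_real (mesh_step x J / 2) * of_real (half_step y k)
             + of_real (mesh_step x J / 2 * vinf * half_step y k) * (W J k * cnj (W J k))
             - of_real (hbar\<^sup>2 / 2 * b1) * (s k * cnj (W J k) * of_real (half_step y k))
             - of_real (mesh_step x J / 2 * (hbar\<^sup>2 / 2 * b2)) * (of_real (half_step y k) * L k * cnj (W J k))"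
      unfolding D_J[OF k] by (simp only: of_real_mult ring_distribs mult_ac)
  qed
  also have "\<dots> = (\<Sum>j\<in>{1..<J}. \<Sum>k\<in>{1..<K}. of_real (half_step x j) * of_real (half_step y k)
             * mesh_hamiltonian hbar B x y W j k * cnj (W j k))
        + (\<Sum>k\<in>{1..<K}. of_real (half_step y k)
             * (of_real (hbar\<^sup>2 / 2 * b1) * bdiff x (\<lambda>j. W j k) J * cnj (W J k)))
        + inner_xy x y J K F W
        - of_real (hbar\<^sup>2 / 2 * b1) * inner_y y K s (W J)
        + (\<Sum>j\<in>{1..<J}. \<Sum>k\<in>{1..<K}.
             of_real (half_step x j * half_step y k * vt j) * (W j k * cnj (W j k)))
        + (\<Sum>k\<in>{1..<K}. of_real (mesh_step x J / 2 * vinf * half_step y k) * (W J k * cnj (W J k)))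
        - of_real (mesh_step x J / 2 * (hbar\<^sup>2 / 2 * b2)) *
            (\<Sum>k\<in>{1..<K}. of_real (half_step y k) * L k * cnj (W J k))"
    by (simp only: inner_xy_def inner_y_def sum.distrib sum_negf sum_distrib_left[symmetric]
        add_ac diff_conv_add_uminus minus_add_distrib)
  finally have split: "inner_xy x y J K D W = \<dots>" .
  have L: "Im (\<Sum>k\<in>{1..<K}. of_real (half_step y k) * L k * cnj (W J k)) = 0"
    using Im_sum_second_difference[OF K, where w = "W J" and b = "\<lambda>k. 1"] W
    by (simp add: L_def vanishes_on_Gamma_def)
  \<comment> \<open>The first two sums of the decomposition cancel in the imaginary part.\<close>
  note flux = Im_mesh_hamiltonian[where B = B and ?b1.0 = b1 and hbar = hbar, OF W sym B12 B11]
  have real: "Im (of_real c * (z * cnj z)) = 0" for c z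
    by (simp add: complex_mult_cnj)
  have "Im (inner_xy x y J K D W)
      = Im (inner_xy x y J K F W) - hbar\<^sup>2 / 2 * b1 * Im (inner_y y K s (W J))"
    unfolding split
    by (simp only: plus_complex.sel minus_complex.sel Im_of_real_mult L flux) (simp only: Im_sum real, simp)
  then have "hbar / (2 * \<tau>) *
      ((norm_xy x y J K (\<lambda>j k. of_real (sqrt (r j k)) * Pt j k))\<^sup>2
       - (norm_xy x y J K (\<lambda>j k. of_real (sqrt (r j k)) * Pb j k))\<^sup>2)
      = Im (inner_xy x y J K F W) - hbar\<^sup>2 / 2 * b1 * Im (inner_y y K s (W J))"
    using mass by simp
  then show ?thesis using pos(1,2) by (simp add: field_simps)
qed

end

section \<open>The splitting factor\<close>

text \<open>
  One variant is a quotient of two conjugate numbers, the other the exponential of an imaginary one.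
\<close>

lemma norm_splitting_factor: "cmod (splitting_factor v hbar \<tau> r dV) = 1"
proof (cases v)
  case Cayley
  have "cmod (1 - \<i> * of_real c) = cmod (1 + \<i> * of_real c)" and "1 + \<i> * of_real c \<noteq> 0" for c
    by (simp_all add: cmod_def complex_eq_iff)
  then show ?thesis using Cayley by (simp add: splitting_factor_def norm_divide del: of_real_mult of_real_divide)
next
  case Exponential
  then show ?thesis by (simp add: splitting_factor_def norm_exp_eq_Re del: of_real_mult of_real_divide)
qed

lemma splitting_factor_0: "splitting_factor v hbar \<tau> r 0 = 1"
  by (cases v) (simp_all add: splitting_factor_def)

section \<open>From the energy inequality to the norm\<close>

text \<open>
  At the index where the maximum \<open>A\<close> over \<open>{0..M}\<close> is attained, the hypothesis becomes
  \<open>A\<^sup>2 \<le> (a 0 + (\<Sum>m=1..M. g m)) * A\<close>, since one factor in each product is at most \<open>A\<close>.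
\<close>

lemma Max_le_of_quadratic_bound:
  fixes a g :: "nat \<Rightarrow> real"
  assumes a: "\<And>m. a m \<ge> 0" and g: "\<And>m. m \<ge> 1 \<Longrightarrow> g m \<ge> 0"
    and energy: "\<And>n. (a n)\<^sup>2 \<le> (a 0)\<^sup>2 + (\<Sum>m=1..n. g m * ((a (m - 1) + a m) / 2))"
  shows "Max (a ` {0..M}) \<le> a 0 + (\<Sum>m=1..M. g m)"
proof -
  define A where "A = Max (a ` {0..M})"
  have le: "a m \<le> A" if "m \<le> M" for m
    unfolding A_def using that by (intro Max_ge) auto
  have "A \<in> a ` {0..M}" unfolding A_def by (intro Max_in) auto
  then obtain n where n: "n \<le> M" "A = a n" by auto
  have "A * A \<le> (a 0)\<^sup>2 + (\<Sum>m=1..n. g m * ((a (m - 1) + a m) / 2))"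
    using energy[of n] n by (simp add: power2_eq_square)
  also have "\<dots> \<le> a 0 * A + (\<Sum>m=1..n. g m * A)"
  proof (intro add_mono sum_mono)
    show "(a 0)\<^sup>2 \<le> a 0 * A"
      unfolding power2_eq_square using a le by (intro mult_left_mono) auto
    fix m assume m: "m \<in> {1..n}"
    then have "a (m - 1) \<le> A" "a m \<le> A"
      using n(1) by (auto intro!: le)
    then show "g m * ((a (m - 1) + a m) / 2) \<le> g m * A"
      using m g[of m] by (intro mult_left_mono) auto
  qed
  also have "\<dots> \<le> a 0 * A + (\<Sum>m=1..M. g m * A)"
    using n a[of n] g by (intro add_left_mono sum_mono2) auto
  also have "\<dots> = (a 0 + (\<Sum>m=1..M. g m)) * A"
    by (simp add: distrib_right sum_distrib_right)
  finally have *: "A * A \<le> (a 0 + (\<Sum>m=1..M. g m)) * A" .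
  have "A \<le> a 0 + (\<Sum>m=1..M. g m)"
  proof (cases "A = 0")
    case True
    then show ?thesis using a[of 0] g by (auto intro!: add_nonneg_nonneg sum_nonneg)
  next
    case False
    then show ?thesis using * a[of n] n by (simp add: mult_le_cancel_right)
  qed
  then show ?thesis by (simp add: A_def)
qed

section \<open>Stability of the splitting scheme\<close>

theorem proposition1:
  fixes hbar Y X X0 \<rho>low \<rho>inf B1inf B2inf Vinf :: real
    and \<rho> V :: "real \<Rightarrow> real \<Rightarrow> real"
    and B :: "real \<Rightarrow> real \<Rightarrow> real^2^2"
    and Vt :: "real \<Rightarrow> real"
    and \<psi>0 :: "real \<Rightarrow> real \<Rightarrow> complex"
    and t x y :: "nat \<Rightarrow> real"
    and J K :: nat
    and S :: "nat \<Rightarrow> (nat \<Rightarrow> nat \<Rightarrow> complex) \<Rightarrow> nat \<Rightarrow> complex"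
    and F \<Psi>b \<Psi>t \<Psi> :: "nat \<Rightarrow> nat \<Rightarrow> nat \<Rightarrow> complex"
    and v :: "nat \<Rightarrow> splitting_variant"
  \<comment> \<open>coefficients\<close>
  assumes "hbar > 0" and "Y > 0" and "X0 > 0"
    and "\<rho>low > 0" and "\<And>a b. (a, b) \<in> strip Y \<Longrightarrow> \<rho> a b \<ge> \<rho>low"
    and "\<And>a b. (a, b) \<in> strip Y \<Longrightarrow> transpose (B a b) = B a b"
    and "\<exists>\<nu>>0. \<forall>(a, b)\<in>strip Y. \<forall>\<xi>. \<xi> \<bullet> (B a b *v \<xi>) \<ge> \<nu> * (norm \<xi>)\<^sup>2"
    and "B1inf > 0" and "B2inf > 0" and "\<rho>inf > 0"
    and "\<And>a b. (a, b) \<in> strip Y - strip_upto X0 Y \<Longrightarrow>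
           B a b $ 1 $ 1 = B1inf \<and> B a b $ 1 $ 2 = 0 \<and> B a b $ 2 $ 1 = 0 \<and> B a b $ 2 $ 2 = B2inf \<and>
           \<rho> a b = \<rho>inf \<and> V a b = Vinf \<and> \<psi>0 a b = 0"
    and "\<And>a. a \<ge> X0 \<Longrightarrow> Vt a = Vinf"
  \<comment> \<open>meshes\<close>
    and "strict_mono t" and "t 0 = 0" and "filterlim t at_top sequentially"
    and "strict_mono x" and "x 0 = 0" and "x J = X" and "X > X0"
    and "J \<ge> 2" and "x (J - 2) \<ge> X0"
    and "\<And>j. j \<ge> J \<Longrightarrow> mesh_step x j = mesh_step x J"
    and "strict_mono_on {0..K} y" and "y 0 = 0" and "y K = Y"
  \<comment> \<open>operators in the transparent boundary condition\<close>
    and "\<And>m. m \<ge> 1 \<Longrightarrow> linear_mesh_operator K m (S m)"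
    and "\<And>(\<Phi> :: nat \<Rightarrow> nat \<Rightarrow> complex) M. M \<ge> 1 \<Longrightarrow> (\<forall>k\<le>K. \<Phi> 0 k = 0) \<Longrightarrow>
           (\<forall>m. \<Phi> m 0 = 0 \<and> \<Phi> m K = 0) \<Longrightarrow>
           Im (\<Sum>m=1..M. inner_y y K (S m \<Phi>) (\<lambda>k. (\<Phi> (m - 1) k + \<Phi> m k) / 2)
                            * of_real (mesh_step t m)) \<ge> 0"
  \<comment> \<open>data of the scheme\<close>
    and "\<And>m. m \<ge> 1 \<Longrightarrow> vanishes_on_Gamma J K (F m)"
    and "\<And>k. k \<le> K \<Longrightarrow> \<psi>0 (x J) (y k) = 0 \<and> \<psi>0 (x (J - 1)) (y k) = 0"
    and "vanishes_on_Gamma J K (\<lambda>j k. \<psi>0 (x j) (y k))"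
  \<comment> \<open>the scheme\<close>
    and "\<And>j k. j \<le> J \<Longrightarrow> k \<le> K \<Longrightarrow> \<Psi> 0 j k = \<psi>0 (x j) (y k)"
    and "\<And>m. m \<ge> 1 \<Longrightarrow> vanishes_on_Gamma J K (\<Psi>b m) \<and> vanishes_on_Gamma J K (\<Psi>t m)
                          \<and> vanishes_on_Gamma J K (\<Psi> m)"
    and "\<And>m j k. m \<ge> 1 \<Longrightarrow> j \<in> {1..J} \<Longrightarrow> k \<in> {1..<K} \<Longrightarrow>
           \<Psi>b m j k = splitting_factor (v m) hbar (mesh_step t m) (node_coeff x y \<rho> j k)
                         (node_coeff x y V j k - node_coeff1 x Vt j) * \<Psi> (m - 1) j k"
    and "\<And>m j k. m \<ge> 1 \<Longrightarrow> j \<in> {1..<J} \<Longrightarrow> k \<in> {1..<K} \<Longrightarrow>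
           \<i> * of_real (hbar * node_coeff x y \<rho> j k) * ((\<Psi>t m j k - \<Psi>b m j k) / of_real (mesh_step t m))
           = mesh_hamiltonian hbar B x y (\<lambda>j k. (\<Psi>t m j k + \<Psi>b m j k) / 2) j k
             + of_real (node_coeff1 x Vt j) * ((\<Psi>t m j k + \<Psi>b m j k) / 2)
             + F m j k"
    and "\<And>m j k. m \<ge> 1 \<Longrightarrow> j \<in> {1..J} \<Longrightarrow> k \<in> {1..<K} \<Longrightarrow>
           \<Psi> m j k = splitting_factor (v m) hbar (mesh_step t m) (node_coeff x y \<rho> j k)
                        (node_coeff x y V j k - node_coeff1 x Vt j) * \<Psi>t m j k"
    and "\<And>m k. m \<ge> 1 \<Longrightarrow> k \<in> {1..<K} \<Longrightarrow>
           of_real (hbar\<^sup>2 / 2 * B1inf) * along_x (bdiff x) (\<lambda>j k. (\<Psi>t m j k + \<Psi>b m j k) / 2) J k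
           - of_real (mesh_step x J / 2) *
               (\<i> * of_real (hbar * \<rho>inf) * ((\<Psi>t m J k - \<Psi>b m J k) / of_real (mesh_step t m))
                + (of_real (hbar\<^sup>2 / 2 * B2inf) *
                     along_y (fdiff y) (along_y (bdiff y) (\<lambda>j k. (\<Psi>t m j k + \<Psi>b m j k) / 2)) J k
                   - of_real Vinf * ((\<Psi>t m J k + \<Psi>b m J k) / 2)))
           + of_real (mesh_step x J / 2) * F m J k
           = of_real (hbar\<^sup>2 / 2 * B1inf) * S m (\<lambda>l. \<Psi>t l J) k"
  shows "\<forall>M\<ge>1.
    (MAX m\<in>{0..M}. norm_xy x y J K (\<lambda>j k. of_real (sqrt (node_coeff x y \<rho> j k)) * \<Psi> m j k))
    \<le> norm_xy x y J K (\<lambda>j k. of_real (sqrt (node_coeff x y \<rho> j k)) * \<psi>0 (x j) (y k))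
      + 2 / hbar * (\<Sum>m=1..M. norm_xy x y J K (\<lambda>j k. F m j k / of_real (sqrt (node_coeff x y \<rho> j k)))
                              * mesh_step t m)"
proof (intro allI impI)
  fix M :: nat assume M: "M \<ge> 1"
  define Em where "Em m = (\<lambda>j k. splitting_factor (v m) hbar (mesh_step t m) (node_coeff x y \<rho> j k)
                         (node_coeff x y V j k - node_coeff1 x Vt j))" for m
  define r where "r = node_coeff x y \<rho>"
  define N where "N = (\<lambda>U. norm_xy x y J K (\<lambda>j k. of_real (sqrt (r j k)) * U j k))"
  define f where "f m = norm_xy x y J K (\<lambda>j k. F m j k / of_real (sqrt (r j k)))" for m
  define W where "W m = (\<lambda>j k. (\<Psi>t m j k + \<Psi>b m j k) / 2)" for m

  have K: "K \<ge> 1"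
    using assms(2,24,25) by (cases K) auto
  have J: "J \<ge> 2" by (fact assms(20))
  have x_less: "x i < x j" if "i < j" for i j
    using assms(16) that by (rule strict_monoD)
  have y_less: "y i < y j" if "i < j" "j \<le> K" for i j
    using strict_mono_onD[OF assms(23), of i j] that by simp
  have hx: "mesh_step x j > 0" if "j \<ge> 1" for j
    using x_less[of "j - 1" j] that by (simp add: mesh_step_def)
  have hy: "mesh_step y k > 0" if "k \<in> {1..K}" for k
    using y_less[of "k - 1" k] that by (simp add: mesh_step_def)
  have ht: "mesh_step t m > 0" if "m \<ge> 1" for m
    using strict_monoD[OF assms(13), of "m - 1" m] that by (simp add: mesh_step_def)
  interpret space_mesh x y J K
    by unfold_locales (use J K hx hy in auto)

  \<comment> \<open>The coefficient hypotheses concern the open strip; every cell midpoint lies in it, and those from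
    column \<open>J\<close> on lie beyond \<open>X0\<close>.\<close>
  have mid_x: "midpoint1 x j > 0" if "j \<ge> 1" for j
  proof -
    have "0 \<le> x (j - 1)"
      using strict_mono_leD[OF assms(16), of 0 "j - 1"] assms(17) by simp
    then show ?thesis using x_less[of "j - 1" j] that by (simp add: midpoint1_def)
  qed
  have mid_x_far: "midpoint1 x j \<ge> X0" if "j \<ge> J" for j
  proof -
    have "x (J - 2) \<le> x (j - 1)" "x (J - 2) \<le> x j"
      using that by (auto intro!: strict_mono_leD[OF assms(16)])
    then show ?thesis using assms(21) by (simp add: midpoint1_def)
  qed
  have mid_y: "0 < midpoint1 y k \<and> midpoint1 y k < Y" if k: "k \<in> {1..K}" for k
  proof -
    have "y 0 \<le> y (k - 1)" "y k \<le> y K"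
      using k by (auto intro!: monotone_onD[OF strict_mono_on_imp_mono_on[OF assms(23)]])
    moreover have "y (k - 1) < y k"
      using k by (intro y_less) auto
    ultimately show ?thesis using assms(24,25) by (simp add: midpoint1_def)
  qed
  have cell: "(midpoint1 x j, midpoint1 y k) \<in> strip Y" if "j \<ge> 1" "k \<in> {1..K}" for j k
    using mid_x[OF that(1)] mid_y[OF that(2)] by (simp add: strip_def)
  have cell_far: "(midpoint1 x j, midpoint1 y k) \<in> strip Y - strip_upto X0 Y"
    if "j \<ge> J" "k \<in> {1..K}" for j k
    using cell[of j k] mid_x_far[OF that(1)] that J by (simp add: strip_upto_def)
  have sym: "B (midpoint1 x j) (midpoint1 y k) $ 2 $ 1 = B (midpoint1 x j) (midpoint1 y k) $ 1 $ 2"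
    if "j \<ge> 1" "k \<in> {1..K}" for j k
  proof -
    have "transpose (B (midpoint1 x j) (midpoint1 y k)) $ 2 $ 1 = B (midpoint1 x j) (midpoint1 y k) $ 1 $ 2"
      by (simp add: transpose_def)
    then show ?thesis by (simp only: assms(6)[OF cell[OF that]])
  qed

  have r_pos: "r j k > 0" if "j \<in> {1..J}" "k \<in> {1..<K}" for j k
  proof -
    have "\<rho> (midpoint1 x i) (midpoint1 y l) > 0" if "i \<ge> 1" "l \<in> {1..K}" for i l
      using assms(4) assms(5)[OF cell[OF that]] by simp
    then show ?thesis
      unfolding r_def node_coeff_def along_x_def along_y_def cell_values_def
      using that by (intro favg_pos hx hy) auto
  qed
  have far_coeff: "node_coeff x y A J k = c"
    if "k \<in> {1..<K}" "\<And>a b. (a, b) \<in> strip Y - strip_upto X0 Y \<Longrightarrow> A a b = c" for A c k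
    unfolding node_coeff_def along_x_def along_y_def cell_values_def
    using that(1) J by (intro favg_eq_const hx hy that(2) cell_far) auto
  have r_J: "r J k = \<rho>inf" if "k \<in> {1..<K}" for k
    unfolding r_def by (intro far_coeff that) (use assms(11) in blast)
  \<comment> \<open>On the column \<open>J\<close> the two nodal potentials coincide, so the three traces of a step reduce to one
    sequence.\<close>
  have "Em m J k = 1" if "k \<in> {1..<K}" for m k
  proof -
    have "node_coeff x y V J k = Vinf"
      by (intro far_coeff that) (use assms(11) in blast)
    moreover have "node_coeff1 x Vt J = Vinf"
      unfolding node_coeff1_def using J by (intro favg_eq_const hx assms(12) mid_x_far) auto
    ultimately show ?thesis by (simp add: Em_def splitting_factor_0)
  qed
  then have trace_b: "\<Psi>b m J k = \<Psi> (m - 1) J k" and trace_t: "\<Psi> m J k = \<Psi>t m J k"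
    if "m \<ge> 1" "k \<in> {1..<K}" for m k
    using assms(33,35)[of m J k] that J by (simp_all add: Em_def)

  have mass_b: "N (\<Psi>b m) = N (\<Psi> (m - 1))" and mass_t: "N (\<Psi> m) = N (\<Psi>t m)" if "m \<ge> 1" for m
    unfolding N_def using assms(33,35) that
    by (auto intro!: norm_xy_cong_cmod simp: norm_mult norm_splitting_factor)

  have step: "(N (\<Psi> m))\<^sup>2 = (N (\<Psi> (m - 1)))\<^sup>2 + 2 * mesh_step t m / hbar *
      (Im (inner_xy x y J K (F m) (W m))
       - hbar\<^sup>2 / 2 * B1inf * Im (inner_y y K (S m (\<lambda>l. \<Psi>t l J)) (W m J)))" if m: "m \<ge> 1" for m
  proof -
    have "(N (\<Psi>t m))\<^sup>2 = (N (\<Psi>b m))\<^sup>2 + 2 * mesh_step t m / hbar *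
      (Im (inner_xy x y J K (F m) (W m))
       - hbar\<^sup>2 / 2 * B1inf * Im (inner_y y K (S m (\<lambda>l. \<Psi>t l J)) (W m J)))"
      unfolding N_def W_def
    proof (rule energy_balance[where B = B and vt = "node_coeff1 x Vt" and ?b2.0 = B2inf and vinf = Vinf])
      fix k assume k: "k \<in> {1..K}"
      from assms(11)[OF cell_far[OF order_refl this]]
      show "B (midpoint1 x J) (midpoint1 y k) $ 1 $ 2 = 0"
        "B (midpoint1 x J) (midpoint1 y k) $ 1 $ 1 = B1inf" by auto
    next
      fix j k assume "j \<in> {1..<J}" "k \<in> {1..<K}"
      from assms(34)[OF m this] show "\<i> * of_real (hbar * r j k) *
          ((\<Psi>t m j k - \<Psi>b m j k) / of_real (mesh_step t m))
        = mesh_hamiltonian hbar B x y (\<lambda>j k. (\<Psi>t m j k + \<Psi>b m j k) / 2) j k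
             + of_real (node_coeff1 x Vt j) * ((\<Psi>t m j k + \<Psi>b m j k) / 2)
             + F m j k" unfolding r_def .
    next
      fix k assume "k \<in> {1..<K}"
      from assms(36)[OF m this] show "of_real (hbar\<^sup>2 / 2 * B1inf) * along_x (bdiff x) (\<lambda>j k. (\<Psi>t m j k + \<Psi>b m j k) / 2) J k
           - of_real (mesh_step x J / 2) *
               (\<i> * of_real (hbar * \<rho>inf) * ((\<Psi>t m J k - \<Psi>b m J k) / of_real (mesh_step t m))
                + (of_real (hbar\<^sup>2 / 2 * B2inf) *
                     along_y (fdiff y) (along_y (bdiff y) (\<lambda>j k. (\<Psi>t m j k + \<Psi>b m j k) / 2)) J k
                   - of_real Vinf * ((\<Psi>t m J k + \<Psi>b m J k) / 2)))
           + of_real (mesh_step x J / 2) * F m J k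
           = of_real (hbar\<^sup>2 / 2 * B1inf) * S m (\<lambda>l. \<Psi>t l J) k" .
    qed (use m assms(1,32) ht r_pos r_J sym in auto)
    then show ?thesis using mass_b[OF m] mass_t[OF m] by simp
  qed

  \<comment> \<open>The hypothesis on \<open>S\<close> is applied to the trace of \<open>\<Psi>t\<close>, whose value at time \<open>0\<close> is set to
    \<open>0\<close>: this is the trace of the initial function, and \<open>S m\<close> sees only the times from \<open>1\<close> on.\<close>
  have outflow: "(\<Sum>m=1..n. mesh_step t m * Im (inner_y y K (S m (\<lambda>l. \<Psi>t l J)) (W m J))) \<ge> 0" for n
  proof (cases "n \<ge> 1")
    case True
    define \<Phi> where "\<Phi> = (\<lambda>m k. if m = 0 then 0 else \<Psi>t m J k)"
    have S_eq: "S m \<Phi> k = S m (\<lambda>l. \<Psi>t l J) k" if "m \<ge> 1" "k \<in> {1..<K}" for m k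
      using assms(26)[OF that(1), unfolded linear_mesh_operator_def, THEN conjunct1,
          rule_format, of \<Phi> "\<lambda>l. \<Psi>t l J" k] that(2)
      by (simp add: \<Phi>_def)
    have avg_eq: "(\<Phi> (m - 1) k + \<Phi> m k) / 2 = W m J k" if "m \<ge> 1" "k \<in> {1..<K}" for m k
    proof (cases "m = 1")
      case True
      then show ?thesis
        using trace_b[OF that] assms(29)[of k] assms(31)[of J k] that(2)
        by (simp add: \<Phi>_def W_def)
    next
      case False
      then show ?thesis
        using trace_b[OF that] trace_t[of "m - 1" k] that
        by (simp add: \<Phi>_def W_def add.commute)
    qed
    have "0 \<le> Im (\<Sum>m=1..n. inner_y y K (S m \<Phi>) (\<lambda>k. (\<Phi> (m - 1) k + \<Phi> m k) / 2)
                            * of_real (mesh_step t m))"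
      using assms(32) by (intro assms(27) True) (auto simp: \<Phi>_def vanishes_on_Gamma_def)
    also have "\<dots> = Im (\<Sum>m=1..n. inner_y y K (S m (\<lambda>l. \<Psi>t l J)) (W m J) * of_real (mesh_step t m))"
      unfolding inner_y_def
      by (intro arg_cong[where f = Im] sum.cong arg_cong2[where f = times] refl)
         (use S_eq avg_eq in auto)
    finally show ?thesis by (simp add: mult.commute)
  qed simp

  \<comment> \<open>The factor \<open>sqrt r\<close> is moved from \<open>F\<close> to \<open>W\<close> before Cauchy--Schwarz is applied.\<close>
  have work: "\<bar>Im (inner_xy x y J K (F m) (W m))\<bar> \<le> f m * ((N (\<Psi> (m - 1)) + N (\<Psi> m)) / 2)"
    if m: "m \<ge> 1" for m
  proof -
    have "inner_xy x y J K (F m) (W m) = inner_xy x y J K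
        (\<lambda>j k. F m j k / of_real (sqrt (r j k))) (\<lambda>j k. of_real (sqrt (r j k)) * W m j k)"
      unfolding inner_xy_eq_sum
    proof (intro sum.cong refl)
      fix j k assume "j \<in> {1..J}" "k \<in> {1..<K}"
      then have "r j k \<noteq> 0" using r_pos by fastforce
      then show "of_real (node_weight j k) * (F m j k * cnj (W m j k))
          = of_real (node_weight j k) * (F m j k / of_real (sqrt (r j k))
              * cnj (of_real (sqrt (r j k)) * W m j k))" by simp
    qed
    then have "\<bar>Im (inner_xy x y J K (F m) (W m))\<bar> \<le> f m * N (W m)"
      unfolding f_def N_def
      by (simp only:) (rule order_trans[OF abs_Im_le_cmod inner_xy_Cauchy_Schwarz])
    also have "f m * N (W m) \<le> f m * ((N (\<Psi> (m - 1)) + N (\<Psi> m)) / 2)"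
    proof (rule mult_left_mono)
      show "N (W m) \<le> (N (\<Psi> (m - 1)) + N (\<Psi> m)) / 2"
        unfolding mass_b[OF m, symmetric] mass_t[OF m] unfolding N_def W_def
        using norm_xy_average_le[of "\<lambda>j k. of_real (sqrt (r j k)) * \<Psi>t m j k"
          "\<lambda>j k. of_real (sqrt (r j k)) * \<Psi>b m j k"]
        by (simp add: distrib_left add.commute)
    qed (simp add: f_def norm_xy_nonneg)
    finally show ?thesis .
  qed

  have energy: "(N (\<Psi> n))\<^sup>2 \<le> (N (\<Psi> 0))\<^sup>2
      + (\<Sum>m=1..n. 2 / hbar * f m * mesh_step t m * ((N (\<Psi> (m - 1)) + N (\<Psi> m)) / 2))" for n
  proof -
    define w where "w m = Im (inner_xy x y J K (F m) (W m))" for m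
    define p where "p m = mesh_step t m * Im (inner_y y K (S m (\<lambda>l. \<Psi>t l J)) (W m J))" for m
    have "(N (\<Psi> n))\<^sup>2 - (N (\<Psi> 0))\<^sup>2 = (\<Sum>m=1..n. (N (\<Psi> m))\<^sup>2 - (N (\<Psi> (m - 1)))\<^sup>2)"
      using sum_telescope''[of 0 n "\<lambda>m. (N (\<Psi> m))\<^sup>2"] by simp
    also have "\<dots> = (\<Sum>m=1..n. 2 / hbar * mesh_step t m * w m - hbar * B1inf * p m)"
    proof (intro sum.cong refl)
      fix m assume "m \<in> {1..n}"
      then have m: "m \<ge> 1" by simp
      show "(N (\<Psi> m))\<^sup>2 - (N (\<Psi> (m - 1)))\<^sup>2
          = 2 / hbar * mesh_step t m * w m - hbar * B1inf * p m"
        unfolding step[OF m] w_def p_def using assms(1)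
        by (simp add: field_simps power2_eq_square)
    qed
    also have "\<dots> = (\<Sum>m=1..n. 2 / hbar * mesh_step t m * w m) - hbar * B1inf * (\<Sum>m=1..n. p m)"
      by (simp add: sum_subtractf sum_distrib_left)
    also have "\<dots> \<le> (\<Sum>m=1..n. 2 / hbar * mesh_step t m * w m)"
      using outflow[of n] assms(1,8) by (simp add: p_def)
    also have "\<dots> \<le> (\<Sum>m=1..n. 2 / hbar * mesh_step t m * (f m * ((N (\<Psi> (m - 1)) + N (\<Psi> m)) / 2)))"
    proof (intro sum_mono mult_left_mono)
      fix m assume "m \<in> {1..n}"
      then have m: "m \<ge> 1" by simp
      show "w m \<le> f m * ((N (\<Psi> (m - 1)) + N (\<Psi> m)) / 2)"
        using work[OF m] by (simp add: w_def)
      show "2 / hbar * mesh_step t m \<ge> 0" using ht[OF m] assms(1) by simp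
    qed
    finally show ?thesis by (simp add: mult_ac)
  qed

  have "Max ((\<lambda>m. N (\<Psi> m)) ` {0..M}) \<le> N (\<Psi> 0) + (\<Sum>m=1..M. 2 / hbar * f m * mesh_step t m)"
  proof (rule Max_le_of_quadratic_bound)
    show "N (\<Psi> m) \<ge> 0" for m unfolding N_def by (rule norm_xy_nonneg)
    show "2 / hbar * f m * mesh_step t m \<ge> 0" if "m \<ge> 1" for m
      using ht[OF that] assms(1) norm_xy_nonneg by (simp add: f_def)
  qed (fact energy)
  moreover have "N (\<Psi> 0) = N (\<lambda>j k. \<psi>0 (x j) (y k))"
    unfolding N_def by (intro norm_xy_cong_cmod) (simp add: assms(31))
  ultimately show "(MAX m\<in>{0..M}. norm_xy x y J K (\<lambda>j k. of_real (sqrt (node_coeff x y \<rho> j k)) * \<Psi> m j k))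
    \<le> norm_xy x y J K (\<lambda>j k. of_real (sqrt (node_coeff x y \<rho> j k)) * \<psi>0 (x j) (y k))
      + 2 / hbar * (\<Sum>m=1..M. norm_xy x y J K (\<lambda>j k. F m j k / of_real (sqrt (node_coeff x y \<rho> j k)))
                              * mesh_step t m)"
    by (simp add: N_def f_def r_def sum_distrib_left mult_ac)
qed

end
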